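(* Let $n\ge1$ and let $K$ be a pure $n$-simplicial complex with $p$ vertices. Then $K$ is a simplicial tree if and only if: (1) there is some $0\le m\le n-1$ such that $K$ has no $(m,n)$-simplicial cycle sequences; (2) $\alpha_{n-1}(K)=(p-n)n+1$; and (3) $\alpha_n(K)=p-n$.
   Context: A simplicial complex on a finite vertex set is a collection of non-empty vertex subsets containing all singletons and closed under non-empty subsets; a $k$-simplex has $k+1$ vertices; $\tau$ is a face of $\sigma$ if $\tau\subseteq\sigma$; $\alpha_k(K)$ is the number of $k$-simplices of $K$. $K$ is a pure $n$-simplicial complex if $\dim K=n$ and every simplex is a face of some $n$-simplex. Let $0\le m\le n-1$. An $(m,n)$-walk sequence is an alternating sequence $\sigma_1,\eta_1,\sigma_2,\dots,\sigma_r,\eta_r,\sigma_{r+1}$ of $m$-simplices $\sigma_k$ and $n$-simplices $\eta_k$ with $\sigma_k\ne\sigma_{k+1}$ both faces of $\eta_k$; it is an $(m,n)$-path sequence if all its simplices are distinct. $K$ is connected if there is an $(n-1,n)$-path sequence between every pair of distinct $(n-1)$-simplices. An $(m,n)$-simplicial cycle sequence is an $(m,n)$-walk sequence with $\sigma_{r+1}=\sigma_1$, $\sigma_p\ne\sigma_q$ and $\eta_p\ne\eta_q$ for $1\le p\ne q\le r$, such that $r\ge3$, $\sigma_1$ is not a face of $\eta_k$ for $2\le k\le r-1$, and for each $2\le z\le r$ there is an $(n-1)$-simplex $\sigma'_z$ which is a face of $\eta_{z-1}$ and $\eta_z$ and has $\sigma_z$ as a face, with the $\sigma'_z$ pairwise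 distinct. $K$ is acyclic if it contains no $(m,n)$-simplicial cycle sequence for any $0\le m\le n-1$. A simplicial tree is a connected acyclic pure $n$-simplicial complex. *)

theory Defs
  imports Main
begin

definition abstract_complex :: "'a set \<Rightarrow> 'a set set \<Rightarrow> bool" where
  "abstract_complex V K \<longleftrightarrow>
     finite V \<and>
     (\<forall>\<sigma>\<in>K. \<sigma> \<noteq> {} \<and> \<sigma> \<subseteq> V) \<and>
     (\<forall>v\<in>V. {v} \<in> K) \<and>
     (\<forall>\<sigma>\<in>K. \<forall>\<tau>. \<tau> \<noteq> {} \<and> \<tau> \<subseteq> \<sigma> \<longrightarrow> \<tau> \<in> K)"

definition simplices :: "'a set set \<Rightarrow> nat \<Rightarrow> 'a set set" where
  "simplices K k = {\<sigma> \<in> K. card \<sigma> = k + 1}"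

definition num_simplices :: "nat \<Rightarrow> 'a set set \<Rightarrow> nat" where
  "num_simplices k K = card (simplices K k)"

definition complex_dim :: "'a set set \<Rightarrow> nat" where
  "complex_dim K = Max ((\<lambda>\<sigma>. card \<sigma> - 1) ` K)"

text \<open>The condition \<open>K \<noteq> {}\<close> is needed because \<open>Max {}\<close> is an unspecified value; the empty complex
  has no dimension \<open>n \<ge> 0\<close>.\<close>

definition pure_complex :: "nat \<Rightarrow> 'a set \<Rightarrow> 'a set set \<Rightarrow> bool" where
  "pure_complex n V K \<longleftrightarrow>
     abstract_complex V K \<and> K \<noteq> {} \<and> complex_dim K = n \<and>
     (\<forall>\<tau>\<in>K. \<exists>\<eta>\<in>simplices K n. \<tau> \<subseteq> \<eta>)"

text \<open>A sequence \<open>\<sigma>\<^sub>1, \<eta>\<^sub>1, \<sigma>\<^sub>2, \<dots>, \<sigma>\<^sub>r, \<eta>\<^sub>r, \<sigma>\<^sub>r\<^sub>+\<^sub>1\<close> is given by its length parameter \<open>r\<close> and two functions;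
  only the values \<open>\<sigma> 1, \<dots>, \<sigma> (r + 1)\<close> and \<open>\<eta> 1, \<dots>, \<eta> r\<close> matter.\<close>

definition walk_seq ::
  "'a set set \<Rightarrow> nat \<Rightarrow> nat \<Rightarrow> nat \<Rightarrow> (nat \<Rightarrow> 'a set) \<Rightarrow> (nat \<Rightarrow> 'a set) \<Rightarrow> bool" where
  "walk_seq K m n r \<sigma> \<eta> \<longleftrightarrow>
     r \<ge> 1 \<and>
     (\<forall>k\<in>{1..r+1}. \<sigma> k \<in> simplices K m) \<and>
     (\<forall>k\<in>{1..r}. \<eta> k \<in> simplices K n) \<and>
     (\<forall>k\<in>{1..r}. \<sigma> k \<noteq> \<sigma> (k+1) \<and> \<sigma> k \<subseteq> \<eta> k \<and> \<sigma> (k+1) \<subseteq> \<eta> k)"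

text \<open>For \<open>m < n\<close> the \<open>\<sigma> i\<close> and \<open>\<eta> j\<close> differ by cardinality, so injectivity of both families says
  that all simplices of the sequence are distinct.\<close>

definition path_seq ::
  "'a set set \<Rightarrow> nat \<Rightarrow> nat \<Rightarrow> nat \<Rightarrow> (nat \<Rightarrow> 'a set) \<Rightarrow> (nat \<Rightarrow> 'a set) \<Rightarrow> bool" where
  "path_seq K m n r \<sigma> \<eta> \<longleftrightarrow>
     walk_seq K m n r \<sigma> \<eta> \<and> inj_on \<sigma> {1..r+1} \<and> inj_on \<eta> {1..r}"

definition connected_complex :: "nat \<Rightarrow> 'a set set \<Rightarrow> bool" where
  "connected_complex n K \<longleftrightarrow>
     (\<forall>\<tau>\<in>simplices K (n-1). \<forall>\<tau>'\<in>simplices K (n-1). \<tau> \<noteq> \<tau>' \<longrightarrow>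
        (\<exists>r \<sigma> \<eta>. path_seq K (n-1) n r \<sigma> \<eta> \<and> \<sigma> 1 = \<tau> \<and> \<sigma> (r+1) = \<tau>'))"

definition cycle_seq ::
  "'a set set \<Rightarrow> nat \<Rightarrow> nat \<Rightarrow> nat \<Rightarrow> (nat \<Rightarrow> 'a set) \<Rightarrow> (nat \<Rightarrow> 'a set) \<Rightarrow> bool" where
  "cycle_seq K m n r \<sigma> \<eta> \<longleftrightarrow>
     walk_seq K m n r \<sigma> \<eta> \<and> \<sigma> (r+1) = \<sigma> 1 \<and>
     inj_on \<sigma> {1..r} \<and> inj_on \<eta> {1..r} \<and>
     r \<ge> 3 \<and>
     (\<forall>k\<in>{2..r-1}. \<not> \<sigma> 1 \<subseteq> \<eta> k) \<and>
     (\<exists>\<sigma>'. (\<forall>z\<in>{2..r}. \<sigma>' z \<in> simplices K (n-1) \<and>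
              \<sigma>' z \<subseteq> \<eta> (z-1) \<and> \<sigma>' z \<subseteq> \<eta> z \<and> \<sigma> z \<subseteq> \<sigma>' z) \<and>
           inj_on \<sigma>' {2..r})"

definition acyclic_complex :: "nat \<Rightarrow> 'a set set \<Rightarrow> bool" where
  "acyclic_complex n K \<longleftrightarrow> (\<forall>m<n. \<not> (\<exists>r \<sigma> \<eta>. cycle_seq K m n r \<sigma> \<eta>))"

definition simplicial_tree :: "nat \<Rightarrow> 'a set \<Rightarrow> 'a set set \<Rightarrow> bool" where
  "simplicial_tree n V K \<longleftrightarrow>
     pure_complex n V K \<and> connected_complex n K \<and> acyclic_complex n K"

end

theory Submission
  imports Defs
begin

text \<open>
  Consider walks of facets in which consecutive facets share a ridge and consecutive ridges differ,
  and call such a walk an \<open>m\<close>-gap if some \<open>m\<close>-simplex lies in its two end facets but in none of the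
  facets between. A shortest \<open>m\<close>-gap is an \<open>(m,n)\<close>-cycle. Without \<open>m\<close>-gaps, the last facet of
  a longest walk meets all others in at most one ridge; removing such leaves one by one gives
  \<open>\<alpha>\<^sub>n\<^sub>-\<^sub>1 \<ge> n \<alpha>\<^sub>n + 1\<close>, with equality only if the complex is connected. Conversely, in a connected complex
  facets can be attached along ridges one at a time, each bringing at most one vertex and \<open>n\<close> ridges,
  so \<open>p \<le> n + \<alpha>\<^sub>n\<close> and \<open>\<alpha>\<^sub>n\<^sub>-\<^sub>1 \<le> n \<alpha>\<^sub>n + 1\<close>. If there are no \<open>0\<close>-gaps, then each leaf has a private
  vertex and \<open>p = n + \<alpha>\<^sub>n\<close>; whereas starting the attachment with the facets of a cycle, for any
  \<open>m\<close>, loses a vertex and gives \<open>p < n + \<alpha>\<^sub>n\<close>.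
\<close>

text \<open>Connectedness via ridges, stated by cuts so that no paths have to be handled.\<close>

definition linked :: "nat \<Rightarrow> 'a set set \<Rightarrow> bool" where
  "linked n F \<longleftrightarrow> (\<forall>G. G \<subset> F \<and> G \<noteq> {} \<longrightarrow> (\<exists>x\<in>G. \<exists>y\<in>F - G. card (x \<inter> y) = n))"

text \<open>No complex occurs here: for a pure complex with \<open>n \<ge> 1\<close>, closure under
  faces makes the union over all facets the set of (n-1)-simplices.\<close>

definition ridges :: "nat \<Rightarrow> 'a set \<Rightarrow> 'a set set" where
  "ridges n x = {\<rho>. \<rho> \<subseteq> x \<and> card \<rho> = n}"

text \<open>For finite facets both intersections in the last clause have size \<open>n\<close>, so
  it says that consecutive ridges differ. Bounds \<open>a\<close>, \<open>b\<close> instead of a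
  length let sub-walks keep their indices.\<close>

definition reduced_walk :: "nat \<Rightarrow> 'a set set \<Rightarrow> nat \<Rightarrow> nat \<Rightarrow> (nat \<Rightarrow> 'a set) \<Rightarrow> bool" where
  "reduced_walk n F a b \<eta> \<longleftrightarrow>
     (\<forall>i. a \<le> i \<and> i \<le> b \<longrightarrow> \<eta> i \<in> F) \<and>
     (\<forall>i. a \<le> i \<and> i < b \<longrightarrow> card (\<eta> i \<inter> \<eta> (Suc i)) = n) \<and>
     (\<forall>i. a \<le> i \<and> Suc i < b \<longrightarrow> \<not> \<eta> (Suc i) \<inter> \<eta> (Suc (Suc i)) \<subseteq> \<eta> i)"

text \<open>\<open>Suc a < b\<close> guarantees an inner facet; otherwise an
  \<open>m\<close>-simplex shared by two adjacent facets would already count as a gap.\<close>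

definition gap_walk ::
  "nat \<Rightarrow> 'a set set \<Rightarrow> nat \<Rightarrow> nat \<Rightarrow> nat \<Rightarrow> (nat \<Rightarrow> 'a set) \<Rightarrow> 'a set \<Rightarrow> bool" where
  "gap_walk n F m a b \<eta> s \<longleftrightarrow>
     reduced_walk n F a b \<eta> \<and> Suc a < b \<and> card s = Suc m \<and> s \<subseteq> \<eta> a \<and> s \<subseteq> \<eta> b \<and>
     (\<forall>k. a < k \<and> k < b \<longrightarrow> \<not> s \<subseteq> \<eta> k)"

definition gap_free :: "nat \<Rightarrow> 'a set set \<Rightarrow> nat \<Rightarrow> bool" where
  "gap_free n F m \<longleftrightarrow> (\<forall>a b \<eta> s. \<not> gap_walk n F m a b \<eta> s)"

section \<open>Gaps and convexity along reduced walks\<close>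

lemma reduced_walk_sub:
  assumes "reduced_walk n F a b \<eta>" "a \<le> i" "j \<le> b"
  shows "reduced_walk n F i j \<eta>"
  using assms unfolding reduced_walk_def by auto

lemma reduced_walk_mono:
  assumes "reduced_walk n F a b \<eta>" "F \<subseteq> F'"
  shows "reduced_walk n F' a b \<eta>"
  using assms unfolding reduced_walk_def by blast

lemma gap_free_subset:
  assumes "gap_free n F m" "F' \<subseteq> F"
  shows "gap_free n F' m"
  using assms reduced_walk_mono unfolding gap_free_def gap_walk_def by metis

text \<open>Every point of \<open>A\<close> extends to a subset of size \<open>Suc m\<close>. This
  transfers containments known for \<open>m\<close>-simplices to facets and ridges.\<close>

lemma subset_by_card_subsets:
  assumes "finite A" "Suc m \<le> card A" "\<And>t. t \<subseteq> A \<Longrightarrow> card t = Suc m \<Longrightarrow> t \<subseteq> B"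
  shows "A \<subseteq> B"
proof
  fix x assume "x \<in> A"
  then obtain t where "{x} \<subseteq> t" "t \<subseteq> A" "card t = Suc m"
    using exists_subset_between[of "{x}" "Suc m" A] assms by auto
  then show "x \<in> B" using assms(3) by auto
qed

text \<open>Two distinct sets of size \<open>n + 1\<close> meet in at most \<open>n\<close> points,
  so a common subset of size \<open>n\<close> fills their intersection.\<close>

lemma inter_eq_common_ridge:
  assumes "card x = Suc n" "card y = Suc n" "x \<noteq> y" "\<rho> \<subseteq> x" "\<rho> \<subseteq> y" "card \<rho> = n"
  shows "x \<inter> y = \<rho>"
proof -
  have fx: "finite x" "finite y" using assms by (metis card.infinite nat.distinct(1))+
  have "x \<inter> y \<subset> x"
    using assms fx by (metis card_subset_eq inf.cobounded1 inf.cobounded2 psubsetI)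
  then have "card (x \<inter> y) < Suc n" using fx assms(1) psubset_card_mono by metis
  then have "card (x \<inter> y) \<le> card \<rho>" using assms(6) by simp
  then show ?thesis using fx assms(4,5) by (metis card_seteq finite_Int le_inf_iff)
qed

text \<open>Since the walk is no gap for \<open>t\<close>, some inner facet contains
  \<open>t\<close>; induction applies to the shorter stretch around \<open>k\<close>. The no-gap
  hypothesis concerns only this stretch and this \<open>t\<close>, so the lemma also applies to
  proper parts of a shortest gap.\<close>

lemma walk_convex:
  assumes "reduced_walk n F i j \<eta>" "card t = Suc m" "t \<subseteq> \<eta> i" "t \<subseteq> \<eta> j"
    and "\<And>i' j'. i \<le> i' \<Longrightarrow> j' \<le> j \<Longrightarrow> \<not> gap_walk n F m i' j' \<eta> t"
    and "i \<le> k" "k \<le> j"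
  shows "t \<subseteq> \<eta> k"
  using assms
proof (induction "j - i" arbitrary: i j rule: less_induct)
  case less
  show ?case
  proof (cases "k = i \<or> k = j")
    case True
    then show ?thesis using less.prems by auto
  next
    case False
    then have k: "i < k" "k < j" using less.prems by auto
    then have "\<not> gap_walk n F m i j \<eta> t" using less.prems(5) by blast
    then obtain l where l: "i < l" "l < j" "t \<subseteq> \<eta> l"
      using less.prems(1-4) k unfolding gap_walk_def by auto
    show ?thesis
    proof (cases "k \<le> l")
      case True
      show ?thesis
      proof (rule less.hyps[of l i])
        show "reduced_walk n F i l \<eta>" using less.prems(1) l reduced_walk_sub by (metis le_refl less_imp_le)
        show "\<not> gap_walk n F m i' j' \<eta> t" if "i \<le> i'" "j' \<le> l" for i' j'
          using that l less.prems(5) by auto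
      qed (use less.prems l k True in auto)
    next
      case False
      show ?thesis
      proof (rule less.hyps[of j l])
        show "reduced_walk n F l j \<eta>" using less.prems(1) l reduced_walk_sub by (metis le_refl less_imp_le)
        show "\<not> gap_walk n F m i' j' \<eta> t" if "l \<le> i'" "j' \<le> j" for i' j'
          using that l less.prems(5) by auto
      qed (use less.prems l k False in auto)
    qed
  qed
qed

text \<open>If the ends agreed, every \<open>m\<close>-face of \<open>\<eta> a\<close> would lie in
  both of them, hence by convexity in the next facet, which shares only \<open>n\<close> points with
  \<open>\<eta> a\<close>.\<close>

lemma reduced_walk_ends_distinct:
  assumes w: "reduced_walk n F a b \<eta>" and "a < b" and gf: "gap_free n F m" and "m < n"
    and cF: "\<And>x. x \<in> F \<Longrightarrow> card x = Suc n"
  shows "\<eta> a \<noteq> \<eta> b"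
proof
  assume eq: "\<eta> a = \<eta> b"
  have c: "card (\<eta> a) = Suc n" "card (\<eta> a \<inter> \<eta> (Suc a)) = n"
    using w \<open>a < b\<close> cF unfolding reduced_walk_def by auto
  then have fin: "finite (\<eta> a)" by (metis card.infinite nat.distinct(1))
  have "\<eta> a \<subseteq> \<eta> (Suc a)"
  proof (rule subset_by_card_subsets[OF fin, of m])
    fix t assume t: "t \<subseteq> \<eta> a" "card t = Suc m"
    show "t \<subseteq> \<eta> (Suc a)"
      by (rule walk_convex[OF w t(2)]) (use t eq gf \<open>a < b\<close> in \<open>auto simp: gap_free_def\<close>)
  qed (use c \<open>m < n\<close> in auto)
  then have "\<eta> a \<inter> \<eta> (Suc a) = \<eta> a" by auto
  then show False using c by auto
qed

section \<open>Leaves, and the lower bound on the number of ridges\<close>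

text \<open>Reduced walks have distinct facets, so a longest one exists. Its last facet is a leaf: a
  neighbour through any ridge but the last would prolong the walk. A leaf may have several
  neighbours, all through the one ridge \<open>\<rho>\<close>.\<close>

lemma exists_leaf:
  assumes fin: "finite F" and ne: "F \<noteq> {}" and gf: "gap_free n F m" and "m < n"
    and cF: "\<And>x. x \<in> F \<Longrightarrow> card x = Suc n"
  obtains \<eta> \<rho> where "\<eta> \<in> F" "\<And>y. y \<in> F \<Longrightarrow> card (\<eta> \<inter> y) = n \<Longrightarrow> \<eta> \<inter> y = \<rho>"
proof -
  define P where "P b \<longleftrightarrow> (\<exists>\<eta>. reduced_walk n F 0 b \<eta>)" for b
  obtain x where "x \<in> F" using ne by auto
  then have P0: "P 0" unfolding P_def reduced_walk_def by (intro exI[of _ "\<lambda>_. x"]) auto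
  have bound: "b \<le> card F" if "P b" for b
  proof -
    obtain \<eta> where w: "reduced_walk n F 0 b \<eta>" using \<open>P b\<close> unfolding P_def by auto
    have "\<eta> i \<noteq> \<eta> j" if "i < j" "j \<le> b" for i j
      by (rule reduced_walk_ends_distinct[OF reduced_walk_sub[OF w] _ gf \<open>m < n\<close> cF])
        (use that in auto)
    then have "inj_on \<eta> {..b}" unfolding inj_on_def by (metis atMost_iff linorder_neqE_nat)
    moreover have "\<eta> ` {..b} \<subseteq> F" using w unfolding reduced_walk_def by auto
    ultimately have "card {..b} \<le> card F" using fin by (metis card_inj_on_le)
    then show ?thesis by simp
  qed
  obtain b where b: "P b" "\<And>c. P c \<Longrightarrow> c \<le> b"
    using ex_has_greatest_nat[of P 0 "\<lambda>b. b" "Suc (card F)"] P0 bound by (auto simp: less_Suc_eq_le)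
  obtain \<eta> where w: "reduced_walk n F 0 b \<eta>" using b unfolding P_def by auto
  have ext: "0 < b \<and> \<eta> b \<inter> y \<subseteq> \<eta> (b - 1)" if y: "y \<in> F" "card (\<eta> b \<inter> y) = n" for y
  proof (rule ccontr)
    assume neg: "\<not> ?thesis"
    have "reduced_walk n F 0 (Suc b) (\<eta>(Suc b := y))"
      unfolding reduced_walk_def
    proof (intro conjI allI impI)
      fix i assume "0 \<le> i \<and> i \<le> Suc b"
      then show "(\<eta>(Suc b := y)) i \<in> F" using w y unfolding reduced_walk_def by auto
    next
      fix i assume "0 \<le> i \<and> i < Suc b"
      then show "card ((\<eta>(Suc b := y)) i \<inter> (\<eta>(Suc b := y)) (Suc i)) = n"
        using w y unfolding reduced_walk_def by (cases "i = b") auto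
    next
      fix i assume "0 \<le> i \<and> Suc i < Suc b"
      then show "\<not> (\<eta>(Suc b := y)) (Suc i) \<inter> (\<eta>(Suc b := y)) (Suc (Suc i)) \<subseteq> (\<eta>(Suc b := y)) i"
        using w y neg unfolding reduced_walk_def by (cases "Suc i = b") auto
    qed
    then have "P (Suc b)" unfolding P_def by blast
    then show False using b(2) by fastforce
  qed
  have \<eta>b: "\<eta> b \<in> F" using w unfolding reduced_walk_def by auto
  show thesis
  \<comment> \<open>For \<open>b = 0\<close> the chosen set degenerates to \<open>\<eta> 0\<close>,
    which is harmless: by \<open>ext\<close> the facet then has no neighbours.\<close>
  proof (rule that[OF \<eta>b, of "\<eta> (b - 1) \<inter> \<eta> b"])
    fix y assume y: "y \<in> F" "card (\<eta> b \<inter> y) = n"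
    note e = ext[OF y]
    have c: "card (\<eta> (b - 1) \<inter> \<eta> b) = n" "\<eta> (b - 1) \<in> F"
      using w e unfolding reduced_walk_def by (auto dest: spec[of _ "b - 1"])
    have "\<eta> (b - 1) \<noteq> \<eta> b" using c cF[OF c(2)] by (metis Int_absorb n_not_Suc_n)
    then show "\<eta> b \<inter> y = \<eta> (b - 1) \<inter> \<eta> b"
      using inter_eq_common_ridge[of "\<eta> (b - 1)" n "\<eta> b" "\<eta> b \<inter> y"] cF c \<eta>b y e by auto
  qed
qed

lemma card_ridges:
  assumes "card x = Suc n"
  shows "finite (ridges n x)" "card (ridges n x) = Suc n"
proof -
  have f: "finite x" using assms by (metis card.infinite nat.distinct(1))
  then show "finite (ridges n x)" unfolding ridges_def by auto
  show "card (ridges n x) = Suc n"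
    unfolding ridges_def using n_subsets[OF f, of n] assms binomial_symmetric[of n "Suc n"] by simp
qed

text \<open>A cut either splits \<open>F\<close>, where linkedness gives a crossing pair, or
  separates \<open>\<eta>\<close> from all of \<open>F\<close>, where \<open>\<eta>\<close> and
  \<open>y\<close> cross it.\<close>

lemma linked_insert:
  assumes "linked n F" "y \<in> F" "card (\<eta> \<inter> y) = n"
  shows "linked n (insert \<eta> F)"
  unfolding linked_def
proof (intro allI impI)
  fix G assume G: "G \<subset> insert \<eta> F \<and> G \<noteq> {}"
  consider "F \<subseteq> G" | "G \<inter> F = {}" | "G \<inter> F \<noteq> {}" "G \<inter> F \<subset> F" by blast
  then show "\<exists>x\<in>G. \<exists>z\<in>insert \<eta> F - G. card (x \<inter> z) = n"
  proof cases
    case 1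
    then have "y \<in> G" "\<eta> \<in> insert \<eta> F - G" using G assms by auto
    then show ?thesis using assms(3) by (metis Int_commute)
  next
    case 2
    then have "\<eta> \<in> G" "y \<in> insert \<eta> F - G" using G assms by auto
    then show ?thesis using assms(3) by blast
  next
    case 3
    then show ?thesis using assms(1) unfolding linked_def by blast
  qed
qed

text \<open>A leaf has \<open>n + 1\<close> ridges and shares at most \<open>\<rho>\<close> with the
  other facets, so removing it loses at least \<open>n\<close> ridges. The equality case is carried
  through the same induction because it yields linkedness of the remainder.\<close>

lemma card_ridges_gap_free:
  assumes "finite F" "F \<noteq> {}" "gap_free n F m" "m < n" "\<And>x. x \<in> F \<Longrightarrow> card x = Suc n"
  shows "n * card F + 1 \<le> card (\<Union> (ridges n ` F)) \<and>
    (card (\<Union> (ridges n ` F)) = n * card F + 1 \<longrightarrow> linked n F)"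
  using assms
proof (induction "card F" arbitrary: F rule: less_induct)
  case less
  note fin = less.prems(1) and cF = less.prems(5)
  obtain \<eta> \<rho> where \<eta>: "\<eta> \<in> F" and leaf: "\<And>y. y \<in> F \<Longrightarrow> card (\<eta> \<inter> y) = n \<Longrightarrow> \<eta> \<inter> y = \<rho>"
    using exists_leaf[OF less.prems] by blast
  define F' where "F' = F - {\<eta>}"
  have F: "F = insert \<eta> F'" "\<eta> \<notin> F'" "finite F'" using \<eta> fin unfolding F'_def by auto
  then have cardF: "card F = Suc (card F')" by simp
  show ?case
  proof (cases "F' = {}")
    case True
    then show ?thesis using F card_ridges[OF cF[OF \<eta>]] unfolding linked_def by auto
  next
    case False
    define R where "R = \<Union> (ridges n ` F')"
    have IH: "n * card F' + 1 \<le> card R" "card R = n * card F' + 1 \<Longrightarrow> linked n F'"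
      using less.hyps[of F'] False F cardF gap_free_subset[OF less.prems(3), of F'] \<open>m < n\<close> cF
      unfolding R_def by auto
    have finR: "finite R" unfolding R_def using F card_ridges(1) cF by auto
    have sub: "y \<in> F' \<Longrightarrow> \<tau> \<in> ridges n \<eta> \<Longrightarrow> \<tau> \<in> ridges n y \<Longrightarrow> \<eta> \<inter> y = \<tau> \<and> card \<tau> = n" for y \<tau>
      using inter_eq_common_ridge[of \<eta> n y \<tau>] cF \<eta> F unfolding ridges_def by auto
    have int: "ridges n \<eta> \<inter> R \<subseteq> {\<rho>}"
    proof
      fix \<tau> assume "\<tau> \<in> ridges n \<eta> \<inter> R"
      then obtain y where "y \<in> F'" "\<tau> \<in> ridges n \<eta>" "\<tau> \<in> ridges n y" unfolding R_def by auto
      then show "\<tau> \<in> {\<rho>}" using sub[of y \<tau>] leaf[of y] F by auto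
    qed
    have total: "card (\<Union> (ridges n ` F)) + card (ridges n \<eta> \<inter> R) = Suc n + card R"
      using card_Un_Int[OF card_ridges(1)[OF cF[OF \<eta>]] finR] card_ridges(2)[OF cF[OF \<eta>]] F(1)
      unfolding R_def by simp
    have le1: "card (ridges n \<eta> \<inter> R) \<le> 1" using card_mono[OF _ int] by simp
    have mul: "n * card F = n + n * card F'" using cardF by simp
    \<comment> \<open>Equality leaves no slack: the remainder attains its own minimum, and the leaf
      shares exactly one ridge with it, which attaches it to a linked set.\<close>
    have "linked n F" if "card (\<Union> (ridges n ` F)) = n * card F + 1"
    proof -
      have "card R = n * card F' + 1" "card (ridges n \<eta> \<inter> R) = 1"
        using that total le1 IH(1) mul by linarith+
      then have "linked n F'" "ridges n \<eta> \<inter> R \<noteq> {}" using IH(2) by auto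
      then obtain y where "y \<in> F'" "card (\<eta> \<inter> y) = n" using sub unfolding R_def by blast
      then show ?thesis using linked_insert[OF \<open>linked n F'\<close>] F(1) by metis
    qed
    moreover have "n * card F + 1 \<le> card (\<Union> (ridges n ` F))"
      using total le1 IH(1) mul by linarith
    ultimately show ?thesis by blast
  qed
qed

section \<open>Private vertices, and the lower bound on the number of vertices\<close>

text \<open>The facets reachable from \<open>x\<close> by reduced walks are closed under adjacency,
  so linkedness makes them all of \<open>F\<close>.\<close>

lemma linked_imp_reduced_walk:
  assumes L: "linked n F" and cF: "\<And>x. x \<in> F \<Longrightarrow> card x = Suc n" and "x \<in> F" "y \<in> F"
  obtains b \<eta> where "reduced_walk n F 0 b \<eta>" "\<eta> 0 = x" "\<eta> b = y"
proof -
  define G where "G = {z. \<exists>b \<eta>. reduced_walk n F 0 b \<eta> \<and> \<eta> 0 = x \<and> \<eta> b = z}"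
  have "x \<in> G" unfolding G_def reduced_walk_def using \<open>x \<in> F\<close>
    by (auto intro!: exI[of _ 0] exI[of _ "\<lambda>_. x"])
  have GF: "G \<subseteq> F" unfolding G_def reduced_walk_def by auto
  have "G = F"
  proof (rule ccontr)
    assume "G \<noteq> F"
    then obtain u z where u: "u \<in> G" and z: "z \<in> F" "z \<notin> G" and uz: "card (u \<inter> z) = n"
      using L GF \<open>x \<in> G\<close> unfolding linked_def by blast
    obtain b \<eta> where w: "reduced_walk n F 0 b \<eta>" "\<eta> 0 = x" "\<eta> b = u"
      using u unfolding G_def by auto
    \<comment> \<open>Stated for every prefix of the walk, because \<open>z\<close> is appended
      either at \<open>b\<close> or, with the last facet dropped, at \<open>b - 1\<close>.\<close>
    have ext: "z \<in> G" if c: "c \<le> b" "card (\<eta> c \<inter> z) = n" "c = 0 \<or> \<not> \<eta> c \<inter> z \<subseteq> \<eta> (c - 1)" for c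
    proof -
      have "reduced_walk n F 0 (Suc c) (\<eta>(Suc c := z))"
        unfolding reduced_walk_def
      proof (intro conjI allI impI)
        fix i assume "0 \<le> i \<and> i \<le> Suc c"
        then show "(\<eta>(Suc c := z)) i \<in> F" using w z c unfolding reduced_walk_def by auto
      next
        fix i assume "0 \<le> i \<and> i < Suc c"
        then show "card ((\<eta>(Suc c := z)) i \<inter> (\<eta>(Suc c := z)) (Suc i)) = n"
          using w c unfolding reduced_walk_def by (cases "i = c") auto
      next
        fix i assume "0 \<le> i \<and> Suc i < Suc c"
        then show "\<not> (\<eta>(Suc c := z)) (Suc i) \<inter> (\<eta>(Suc c := z)) (Suc (Suc i)) \<subseteq> (\<eta>(Suc c := z)) i"
          using w c unfolding reduced_walk_def by (cases "Suc i = c") auto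
      qed
      then show ?thesis unfolding G_def using w(2) by force
    qed
    \<comment> \<open>If appending \<open>z\<close> breaks reducedness, then \<open>z\<close> shares its ridge with the last two facets
      of the walk and can replace the last one.\<close>
    have "\<not> (b = 0 \<or> \<not> \<eta> b \<inter> z \<subseteq> \<eta> (b - 1))" using ext[of b] z(2) uz w(3) by blast
    then have b: "0 < b" "\<eta> b \<inter> z \<subseteq> \<eta> (b - 1)" by auto
    define c where "c = b - 1"
    have bc: "b = Suc c" using b(1) c_def by simp
    have mem: "\<eta> c \<in> F" "\<eta> b \<in> F" and cc: "card (\<eta> c \<inter> \<eta> b) = n"
      using w(1) bc unfolding reduced_walk_def by auto
    have nz: "\<eta> c \<noteq> z" using z(2) reduced_walk_sub[OF w(1), of 0 c] w(2) bc unfolding G_def by auto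
    have nb: "\<eta> c \<noteq> \<eta> b" using cc cF[OF mem(1)] by auto
    have e1: "\<eta> c \<inter> z = \<eta> b \<inter> z" 
      using inter_eq_common_ridge[of "\<eta> c" n z "\<eta> b \<inter> z"] cF mem z uz w(3) b(2) nz c_def by auto
    have e2: "\<eta> c \<inter> \<eta> b = \<eta> b \<inter> z" 
      using inter_eq_common_ridge[of "\<eta> c" n "\<eta> b" "\<eta> b \<inter> z"] cF mem uz w(3) b(2) nb c_def by auto
    \<comment> \<open>Both \<open>\<eta> b\<close> and \<open>z\<close> meet \<open>\<eta> c\<close>
      in the same ridge, so reducedness of the old walk carries over to the replacement.\<close>
    have "c = 0 \<or> \<not> \<eta> c \<inter> z \<subseteq> \<eta> (c - 1)"
    proof (cases c)
      case (Suc d)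
      then have "\<not> \<eta> c \<inter> \<eta> b \<subseteq> \<eta> d" using w(1) bc unfolding reduced_walk_def by auto
      then show ?thesis using e1 e2 Suc by auto
    qed simp
    then have "z \<in> G" using ext[of c] e1 uz w(3) bc by auto
    then show False using z(2) by blast
  qed
  then show thesis using that \<open>y \<in> F\<close> unfolding G_def by blast
qed

text \<open>All neighbours of a leaf contain \<open>\<rho>\<close> and are therefore adjacent to one
  another, so a connection through the leaf can bypass it. The cuts \<open>G\<close> and
  \<open>insert \<eta> G\<close> supply a neighbour on either side.\<close>

lemma linked_remove_leaf:
  assumes L: "linked n F" and cF: "\<And>x. x \<in> F \<Longrightarrow> card x = Suc n" and "\<eta> \<in> F"
    and leaf: "\<And>y. y \<in> F \<Longrightarrow> card (\<eta> \<inter> y) = n \<Longrightarrow> \<eta> \<inter> y = \<rho>"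
  shows "linked n (F - {\<eta>})"
  unfolding linked_def
proof (intro allI impI)
  fix G assume G: "G \<subset> F - {\<eta>} \<and> G \<noteq> {}"
  have "G \<subset> F" using G by blast
  then obtain x y where xy: "x \<in> G" "y \<in> F - G" "card (x \<inter> y) = n"
    using L G unfolding linked_def by blast
  have "insert \<eta> G \<subset> F" using G \<open>\<eta> \<in> F\<close> by blast
  then obtain x' y' where xy': "x' \<in> insert \<eta> G" "y' \<in> F - insert \<eta> G" "card (x' \<inter> y') = n"
    using L G unfolding linked_def by (metis insert_not_empty)
  consider "y \<noteq> \<eta>" | "x' \<noteq> \<eta>" | "y = \<eta>" "x' = \<eta>" by blast
  then show "\<exists>x\<in>G. \<exists>y\<in>F - {\<eta>} - G. card (x \<inter> y) = n"
  proof cases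
    case 3
    have "\<eta> \<inter> x = \<rho>" "\<eta> \<inter> y' = \<rho>" "card \<rho> = n"
      using leaf[of x] leaf[of y'] 3 xy xy' \<open>G \<subset> F\<close> by (auto simp: Int_commute)
    then have "x \<inter> y' = \<rho>"
      using inter_eq_common_ridge[of x n y' \<rho>] cF xy xy' \<open>G \<subset> F\<close> by auto
    then show ?thesis using xy xy' \<open>card \<rho> = n\<close> by blast
  qed (use xy xy' in blast)+
qed

text \<open>The vertex \<open>v\<close> of a leaf off its ridge \<open>\<rho>\<close> lies in no
  other facet: a reduced walk from the leaf to such a facet leaves through \<open>\<rho>\<close>,
  and convexity would put \<open>v\<close> there. So removing a leaf loses a vertex.\<close>

lemma card_vertices_gap_free:
  assumes "finite F" "F \<noteq> {}" "gap_free n F 0" "0 < n" "linked n F"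
    "\<And>x. x \<in> F \<Longrightarrow> card x = Suc n"
  shows "n + card F \<le> card (\<Union> F)"
  using assms
proof (induction "card F" arbitrary: F rule: less_induct)
  case less
  note fin = less.prems(1) and cF = less.prems(6) and L = less.prems(5)
  obtain \<eta> \<rho> where \<eta>: "\<eta> \<in> F" and leaf: "\<And>y. y \<in> F \<Longrightarrow> card (\<eta> \<inter> y) = n \<Longrightarrow> \<eta> \<inter> y = \<rho>"
    using exists_leaf[OF less.prems(1-4,6)] by blast
  define F' where "F' = F - {\<eta>}"
  have F: "F = insert \<eta> F'" "\<eta> \<notin> F'" "finite F'" using \<eta> fin unfolding F'_def by auto
  then have cardF: "card F = Suc (card F')" by simp
  have finV: "finite (\<Union> F)" using fin cF by (metis card.infinite finite_Union nat.distinct(1))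
  show ?case
  proof (cases "F' = {}")
    case True
    then show ?thesis using F cF[OF \<eta>] by auto
  next
    case False
    have "linked n F'" using linked_remove_leaf[OF L cF \<eta> leaf] unfolding F'_def by blast
    then have IH: "n + card F' \<le> card (\<Union> F')"
      using less.hyps[of F'] False F cardF gap_free_subset[OF less.prems(3), of F'] \<open>0 < n\<close> cF by auto
    \<comment> \<open>The leaf really has a neighbour, so \<open>\<rho>\<close> is one of its ridges
      and not an arbitrary set.\<close>
    have "{\<eta>} \<subset> F" using F False by blast
    then obtain y where "y \<in> F" "card (\<eta> \<inter> y) = n" using L unfolding linked_def by blast
    then have \<rho>: "\<rho> \<subseteq> \<eta>" "card \<rho> = n" using leaf by auto
    then obtain v where v: "v \<in> \<eta>" "v \<notin> \<rho>" using cF[OF \<eta>] by (metis n_not_Suc_n subsetI subset_antisym)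
    have "v \<notin> \<Union> F'"
    proof
      assume "v \<in> \<Union> F'"
      then obtain z where z: "z \<in> F'" "v \<in> z" by blast
      obtain b \<theta> where w: "reduced_walk n F 0 b \<theta>" "\<theta> 0 = \<eta>" "\<theta> b = z"
        using linked_imp_reduced_walk[OF L cF \<eta>, of z] z F by blast
      have "0 < b" using w z F(2) by (metis gr0I)
      then have "\<theta> 0 \<inter> \<theta> 1 = \<rho>" using leaf[of "\<theta> 1"] w unfolding reduced_walk_def by auto
      moreover have "{v} \<subseteq> \<theta> 1"
        by (rule walk_convex[OF w(1), of _ 0])
          (use less.prems(3) w(2,3) v z \<open>0 < b\<close> in \<open>auto simp: gap_free_def\<close>)
      ultimately show False using v w(2) by auto
    qed
    then have "\<Union> F' \<subset> \<Union> F" using v F by blast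
    then have "card (\<Union> F') < card (\<Union> F)" using finV by (metis psubset_card_mono)
    then show ?thesis using IH cardF by simp
  qed
qed

section \<open>Upper bounds by attaching facets one at a time\<close>

text \<open>Linkedness always offers a facet adjacent to one already present, which adds at most
  \<open>c\<close> elements. Taking \<open>f\<close> to be the identity counts vertices, taking
  \<open>ridges n\<close> counts ridges; the additive form avoids subtraction of naturals.\<close>

lemma linked_growth:
  fixes f :: "'a set \<Rightarrow> 'b set"
  assumes "linked n F" "finite F" "G \<subseteq> F" "G \<noteq> {}" "\<And>x. x \<in> F \<Longrightarrow> finite (f x)"
    and "\<And>x y. x \<in> F \<Longrightarrow> y \<in> F \<Longrightarrow> card (x \<inter> y) = n \<Longrightarrow> card (f y - f x) \<le> c"
  shows "card (\<Union> (f ` F)) + c * card G \<le> card (\<Union> (f ` G)) + c * card F"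
  using assms
proof (induction "card (F - G)" arbitrary: G)
  case 0
  then have "G = F" by auto
  then show ?case by simp
next
  case (Suc k)
  then have "G \<subset> F" by auto
  then obtain x y where xy: "x \<in> G" "y \<in> F - G" "card (x \<inter> y) = n"
    using Suc.prems(1,4) unfolding linked_def by blast
  have finG: "finite G" using Suc.prems(2,3) finite_subset by blast
  have "F - insert y G = (F - G) - {y}" by blast
  then have "card (F - insert y G) = k" using Suc.hyps(2) xy Suc.prems(2) by simp
  then have "card (\<Union> (f ` F)) + c * card (insert y G) \<le> card (\<Union> (f ` insert y G)) + c * card F"
    using Suc.hyps(1)[of "insert y G"] Suc.prems xy by auto
  moreover have "card (insert y G) = Suc (card G)" using xy finG by simp
  moreover have "card (\<Union> (f ` insert y G)) \<le> card (\<Union> (f ` G)) + c"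
  proof -
    have fin: "finite (\<Union> (f ` G))" "finite (f y)" using finG Suc.prems(3,5) xy by auto
    have "\<Union> (f ` insert y G) \<subseteq> \<Union> (f ` G) \<union> (f y - f x)" using xy by auto
    then have "card (\<Union> (f ` insert y G)) \<le> card (\<Union> (f ` G) \<union> (f y - f x))"
      using fin by (intro card_mono) auto
    also have "\<dots> \<le> card (\<Union> (f ` G)) + card (f y - f x)" by (rule card_Un_le)
    also have "\<dots> \<le> card (\<Union> (f ` G)) + c" using Suc.prems(6)[of x y] xy Suc.prems(3) by auto
    finally show ?thesis .
  qed
  ultimately show ?case by simp
qed

text \<open>Vertices minus facets never increases during the attachment. The start \<open>G\<close>
  stays arbitrary so that it can consist of facets of a cycle.\<close>

lemma linked_card_vertices_le:
  assumes "linked n F" "finite F" "G \<subseteq> F" "G \<noteq> {}" and cF: "\<And>x. x \<in> F \<Longrightarrow> card x = Suc n"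
  shows "card (\<Union> F) + card G \<le> card (\<Union> G) + card F"
proof -
  have fin: "finite x" if "x \<in> F" for x using cF[OF that] by (metis card.infinite nat.distinct(1))
  have "card (y - x) \<le> 1" if "x \<in> F" "y \<in> F" "card (x \<inter> y) = n" for x y
    using that card_Diff_subset_Int[of y x] fin cF by (auto simp: Int_commute)
  then show ?thesis using linked_growth[OF assms(1-4), of "\<lambda>x. x" 1] fin by simp
qed

text \<open>The ridge through which a facet is attached has been counted already, so at most
  \<open>n\<close> of its \<open>n + 1\<close> ridges are new.\<close>

lemma linked_card_ridges_le:
  assumes "linked n F" "finite F" "F \<noteq> {}" and cF: "\<And>x. x \<in> F \<Longrightarrow> card x = Suc n"
  shows "card (\<Union> (ridges n ` F)) \<le> n * card F + 1"
proof -
  obtain x where x: "x \<in> F" using assms by blast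
  have "card (ridges n y - ridges n x) \<le> n" if "x \<in> F" "y \<in> F" "card (x \<inter> y) = n" for x y
  proof -
    have "ridges n y - ridges n x \<subseteq> ridges n y - {x \<inter> y}" using that unfolding ridges_def by auto
    then have "card (ridges n y - ridges n x) \<le> card (ridges n y - {x \<inter> y})"
      using card_ridges(1)[OF cF] that by (intro card_mono) auto
    also have "\<dots> = n" using card_ridges[OF cF] that
      by (subst card_Diff_singleton) (auto simp: ridges_def)
    finally show ?thesis .
  qed
  then have "card (\<Union> (ridges n ` F)) + n * card {x} \<le> card (\<Union> (ridges n ` {x})) + n * card F"
    using card_ridges(1)[OF cF] x by (intro linked_growth[OF assms(1,2)]) auto
  then show ?thesis using card_ridges(2)[OF cF[OF x]] by simp
qed


section \<open>The vertex lost by a cycle\<close>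

text \<open>Consecutive facets of the cycle are adjacent through the \<open>\<sigma>'\<close>, so
  each brings one vertex at most. A vertex of \<open>\<sigma> 1\<close> that is dropped and later
  returns makes some facet \<open>\<eta> k\<close> bring none; attaching the remaining facets
  preserves this deficit.\<close>

lemma cycle_imp_card_vertices_less:
  assumes L: "linked n (simplices K n)" and fin: "finite (simplices K n)"
    and cyc: "cycle_seq K m n r \<sigma> \<eta>" and "1 \<le> n"
  shows "card (\<Union> (simplices K n)) < n + card (simplices K n)"
proof -
  let ?F = "simplices K n"
  have cF: "card x = Suc n" if "x \<in> ?F" for x using that unfolding simplices_def by auto
  have finx: "finite x" if "x \<in> ?F" for x using cF[OF that] by (metis card.infinite nat.distinct(1))
  have r: "3 \<le> r" and inj: "inj_on \<eta> {1..r}" and \<eta>F: "\<And>k. 1 \<le> k \<Longrightarrow> k \<le> r \<Longrightarrow> \<eta> k \<in> ?F"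
    and walk: "\<And>k. 1 \<le> k \<Longrightarrow> k \<le> r \<Longrightarrow> \<sigma> k \<subseteq> \<eta> k \<and> \<sigma> (k+1) \<subseteq> \<eta> k"
    and s': "\<sigma> (r+1) = \<sigma> 1" "\<not> \<sigma> 1 \<subseteq> \<eta> 2"
    using cyc unfolding cycle_seq_def walk_seq_def by auto
  have s: "\<sigma> 1 \<subseteq> \<eta> 1" "\<sigma> 1 \<subseteq> \<eta> r" "\<not> \<sigma> 1 \<subseteq> \<eta> 2"
    using walk[of 1] walk[of r] s' r by auto
  obtain \<sigma>' where \<sigma>': "\<forall>z\<in>{2..r}. \<sigma>' z \<in> simplices K (n-1) \<and> \<sigma>' z \<subseteq> \<eta> (z-1) \<and> \<sigma>' z \<subseteq> \<eta> z"
    using cyc unfolding cycle_seq_def by blast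
  have diff: "card (\<eta> (Suc j) - \<eta> j) = 1" if "1 \<le> j" "Suc j \<le> r" for j
  proof -
    have "card (\<sigma>' (Suc j)) = n" "\<sigma>' (Suc j) \<subseteq> \<eta> j" "\<sigma>' (Suc j) \<subseteq> \<eta> (Suc j)"
      using \<sigma>'[rule_format, of "Suc j"] that \<open>1 \<le> n\<close> unfolding simplices_def by auto
    moreover have "\<eta> (Suc j) \<noteq> \<eta> j" using inj_onD[OF inj, of "Suc j" j] that by auto
    ultimately have "card (\<eta> (Suc j) \<inter> \<eta> j) = n"
      using inter_eq_common_ridge[of "\<eta> (Suc j)" n "\<eta> j"] cF[OF \<eta>F] that by auto
    then show ?thesis
      using card_Diff_subset_Int[of "\<eta> (Suc j)" "\<eta> j"] cF[OF \<eta>F] finx[OF \<eta>F] that by auto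
  qed
  have bound: "1 \<le> j \<Longrightarrow> j \<le> r \<Longrightarrow> card (\<Union> (\<eta> ` {1..j})) \<le> n + j" for j
  proof (induction j)
    case (Suc j)
    show ?case
    proof (cases "j = 0")
      case True
      then show ?thesis using cF[OF \<eta>F] Suc.prems by simp
    next
      case False
      have "\<Union> (\<eta> ` {1..Suc j}) = \<Union> (\<eta> ` {1..j}) \<union> (\<eta> (Suc j) - \<eta> j)"
        using False by (force simp: atLeastAtMostSuc_conv)
      then have "card (\<Union> (\<eta> ` {1..Suc j})) \<le> card (\<Union> (\<eta> ` {1..j})) + card (\<eta> (Suc j) - \<eta> j)"
        by (metis card_Un_le)
      then show ?thesis using Suc False diff[of j] by auto
    qed
  qed simp
  obtain u where u: "u \<in> \<sigma> 1" "u \<notin> \<eta> 2" using s by blast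
  \<comment> \<open>\<open>k\<close> is the index at which \<open>u\<close> returns. It exists and
    is at most \<open>r\<close> because \<open>u\<close> lies in \<open>\<eta> r\<close>; searching
    from 3 on skips \<open>\<eta> 1\<close>, which contains \<open>u\<close> as well.\<close>
  define k where "k = (LEAST k. 3 \<le> k \<and> u \<in> \<eta> k)"
  have ur: "3 \<le> r \<and> u \<in> \<eta> r" using r s u by auto
  have k: "3 \<le> k" "u \<in> \<eta> k" "k \<le> r"
    using LeastI[of "\<lambda>k. 3 \<le> k \<and> u \<in> \<eta> k", OF ur] Least_le[of "\<lambda>k. 3 \<le> k \<and> u \<in> \<eta> k", OF ur]
    unfolding k_def by auto
  define j where "j = k - 1"
  have kj: "k = Suc j" "2 \<le> j" using k j_def by auto
  have uj: "u \<notin> \<eta> j"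
  proof
    assume "u \<in> \<eta> j"
    then have "3 \<le> j \<and> u \<in> \<eta> j" using kj u(2) by (cases "j = 2") auto
    then have "k \<le> j" unfolding k_def by (rule Least_le)
    then show False using kj by simp
  qed
  \<comment> \<open>The only vertex new relative to the preceding facet is \<open>u\<close>, and
    \<open>\<eta> 1\<close> has contributed it already.\<close>
  then have "\<eta> k - \<eta> j = {u}" using diff[of j] kj k by (metis DiffI card_1_singletonE le_trans one_le_numeral singletonD)
  then have "\<eta> k \<subseteq> \<Union> (\<eta> ` {1..j})" using s u kj by force
  then have "\<Union> (\<eta> ` {1..k}) = \<Union> (\<eta> ` {1..j})" using kj by (auto simp: atLeastAtMostSuc_conv)
  then have "card (\<Union> (\<eta> ` {1..k})) \<le> n + j" using bound[of j] kj k by simp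
  moreover have "card (\<eta> ` {1..k}) = k"
    using card_image[OF inj_on_subset[OF inj, of "{1..k}"]] k by simp
  moreover have "card (\<Union> ?F) + card (\<eta> ` {1..k}) \<le> card (\<Union> (\<eta> ` {1..k})) + card ?F"
    using \<eta>F k cF by (intro linked_card_vertices_le[OF L fin]) auto
  ultimately show ?thesis using kj by linarith
qed

section \<open>Linkedness and connectedness by path sequences\<close>

text \<open>Follow a path from a ridge of a facet in \<open>G\<close> to a ridge of a facet outside.
  Where the ridges cease to lie in members of \<open>G\<close>, the facet \<open>\<eta> k\<close> is
  outside \<open>G\<close> but shares \<open>\<sigma> k\<close> with a member.\<close>

lemma connected_imp_linked:
  assumes C: "connected_complex n K" and "1 \<le> n" and A: "abstract_complex V K"
  shows "linked n (simplices K n)"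
  unfolding linked_def
proof (intro allI impI)
  let ?F = "simplices K n"
  fix G assume G: "G \<subset> ?F \<and> G \<noteq> {}"
  have adj: "card (x \<inter> y) = n"
    if "x \<in> G" "y \<in> ?F - G" "\<tau> \<in> simplices K (n - 1)" "\<tau> \<subseteq> x" "\<tau> \<subseteq> y" for x y \<tau>
  proof -
    have "x \<inter> y = \<tau>" 
      using that G \<open>1 \<le> n\<close> by (intro inter_eq_common_ridge) (auto simp: simplices_def)
    then show ?thesis using that \<open>1 \<le> n\<close> by (auto simp: simplices_def)
  qed
  have facet_ridge: "\<exists>\<tau>. \<tau> \<in> simplices K (n - 1) \<and> \<tau> \<subseteq> x" if x: "x \<in> ?F" for x
  proof -
    have "n \<le> card x" using x unfolding simplices_def by auto
    then obtain \<tau> where \<tau>: "\<tau> \<subseteq> x" "card \<tau> = n" by (metis obtain_subset_with_card_n)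
    then have "\<tau> \<noteq> {}" using \<open>1 \<le> n\<close> by auto
    then have "\<tau> \<in> K" using A x \<tau> unfolding abstract_complex_def simplices_def by blast
    then show ?thesis using \<tau> \<open>1 \<le> n\<close> unfolding simplices_def by auto
  qed
  obtain x y where x: "x \<in> G" and y: "y \<in> ?F - G" using G by blast
  obtain \<tau> \<tau>' where \<tau>: "\<tau> \<in> simplices K (n - 1)" "\<tau> \<subseteq> x"
    and \<tau>': "\<tau>' \<in> simplices K (n - 1)" "\<tau>' \<subseteq> y"
    using facet_ridge[of x] facet_ridge[of y] x y G by blast
  show "\<exists>x\<in>G. \<exists>y\<in>?F - G. card (x \<inter> y) = n"
  \<comment> \<open>The first case covers \<open>\<tau> = \<tau>'\<close>, for which connectedness
    provides no path.\<close>
  proof (cases "\<exists>z\<in>G. \<tau>' \<subseteq> z")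
    case True
    then show ?thesis using adj[OF _ y \<tau>'(1) _ \<tau>'(2)] y by blast
  next
    case False
    then have "\<tau> \<noteq> \<tau>'" using x \<tau> by blast
    then obtain r \<sigma> \<eta> where w: "walk_seq K (n-1) n r \<sigma> \<eta>" and ends: "\<sigma> 1 = \<tau>" "\<sigma> (r+1) = \<tau>'"
      using C \<tau> \<tau>' unfolding connected_complex_def path_seq_def by blast
    have "\<exists>k\<in>{1..r}. (\<exists>z\<in>G. \<sigma> k \<subseteq> z) \<and> \<not> (\<exists>z\<in>G. \<sigma> (k+1) \<subseteq> z)"
    proof (rule ccontr)
      assume neg: "\<not> ?thesis"
      have "k \<le> r \<Longrightarrow> \<exists>z\<in>G. \<sigma> (k + 1) \<subseteq> z" for k
      proof (induction k)
        case 0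
        then show ?case using ends x \<tau> by auto
      next
        case (Suc k)
        then have "Suc k \<in> {1..r}" "\<exists>z\<in>G. \<sigma> (Suc k) \<subseteq> z" by auto
        then show ?case using neg by (metis Suc_eq_plus1)
      qed
      then show False using False ends by auto
    qed
    then obtain k z where k: "k \<in> {1..r}" "z \<in> G" "\<sigma> k \<subseteq> z" "\<not> (\<exists>z\<in>G. \<sigma> (k+1) \<subseteq> z)" by blast
    have "\<sigma> k \<in> simplices K (n-1)" "\<eta> k \<in> ?F" "\<sigma> k \<subseteq> \<eta> k" "\<sigma> (k+1) \<subseteq> \<eta> k"
      using w k(1) unfolding walk_seq_def by auto
    then show ?thesis using adj[of z "\<eta> k" "\<sigma> k"] k by blast
  qed
qed

lemma path_seq_single:
  assumes "\<tau> \<in> simplices K m" "\<tau>' \<in> simplices K m" "y \<in> simplices K n" "\<tau> \<subseteq> y" "\<tau>' \<subseteq> y" "\<tau> \<noteq> \<tau>'"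
  shows "\<exists>r \<sigma> \<eta>. path_seq K m n r \<sigma> \<eta> \<and> \<sigma> 1 = \<tau> \<and> \<sigma> (r+1) = \<tau>'"
proof (intro exI conjI)
  have "{1..1 + 1} = {1, 2::nat}" by auto
  then show "path_seq K m n 1 (\<lambda>i. if i = 1 then \<tau> else \<tau>') (\<lambda>_. y)"
    using assms unfolding path_seq_def walk_seq_def by simp
qed auto

lemma path_seq_truncate:
  assumes P: "path_seq K m n r \<sigma> \<eta>" and k: "1 \<le> k" "k \<le> r"
  shows "path_seq K m n k \<sigma> \<eta>"
  using P k inj_on_subset[of \<sigma> "{1..r+1}" "{1..k+1}"] inj_on_subset[of \<eta> "{1..r}" "{1..k}"]
  unfolding path_seq_def walk_seq_def by auto

text \<open>Appending may repeat a simplex, in which case the path is shortened: it stops where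
  \<open>\<tau>'\<close> already occurs, or turns to \<open>\<tau>'\<close> at the place where
  \<open>y\<close> already occurs.\<close>

lemma path_seq_extend:
  assumes P: "path_seq K m n r \<sigma> \<eta>" and y: "y \<in> simplices K n" "\<sigma> (r+1) \<subseteq> y"
    and \<tau>': "\<tau>' \<in> simplices K m" "\<tau>' \<subseteq> y" "\<tau>' \<noteq> \<sigma> 1"
  shows "\<exists>r' \<sigma>' \<eta>'. path_seq K m n r' \<sigma>' \<eta>' \<and> \<sigma>' 1 = \<sigma> 1 \<and> \<sigma>' (r'+1) = \<tau>'"
proof -
  \<comment> \<open>Keeps the first \<open>k\<close> facets and continues through \<open>y\<close>;
    \<open>k = 0\<close> is allowed and serves the case \<open>y = \<eta> 1\<close>.\<close>
  have app: "path_seq K m n (Suc k) (\<sigma>(k+2 := \<tau>')) (\<eta>(k+1 := y))"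
    if k: "k \<le> r" "\<sigma> (k+1) \<subseteq> y" "y \<notin> \<eta> ` {1..k}" "\<tau>' \<notin> \<sigma> ` {1..k+1}" for k
  proof -
    have W: "walk_seq K m n r \<sigma> \<eta>" and I: "inj_on \<sigma> {1..r+1}" "inj_on \<eta> {1..r}"
      using P unfolding path_seq_def by auto
    have e: "{1..Suc k + 1} = insert (k+2) {1..k+1}" "{1..Suc k} = insert (k+1) {1..k}" by auto
    have "inj_on \<sigma> {1..k+1}" "inj_on \<eta> {1..k}"
      using I k(1) by (auto intro: inj_on_subset)
    then have "inj_on (\<sigma>(k+2 := \<tau>')) {1..Suc k + 1}" "inj_on (\<eta>(k+1 := y)) {1..Suc k}"
      unfolding e using k(3,4) by (auto simp: fun_upd_image intro!: inj_on_fun_updI)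
    moreover have "walk_seq K m n (Suc k) (\<sigma>(k+2 := \<tau>')) (\<eta>(k+1 := y))"
      unfolding walk_seq_def
    proof (intro conjI ballI)
      fix i assume "i \<in> {1..Suc k + 1}"
      then show "(\<sigma>(k+2 := \<tau>')) i \<in> simplices K m"
        using W k(1) \<tau>' unfolding walk_seq_def by auto
    next
      fix i assume "i \<in> {1..Suc k}"
      then have i: "i = k + 1 \<or> (i \<noteq> k + 1 \<and> i \<in> {1..k})" by auto
      show "(\<eta>(k+1 := y)) i \<in> simplices K n"
        using i W k(1) y unfolding walk_seq_def by auto
      show "(\<sigma>(k+2 := \<tau>')) i \<noteq> (\<sigma>(k+2 := \<tau>')) (i+1)"
        using i W k unfolding walk_seq_def by auto
      show "(\<sigma>(k+2 := \<tau>')) i \<subseteq> (\<eta>(k+1 := y)) i"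
        using i W k unfolding walk_seq_def by auto
      show "(\<sigma>(k+2 := \<tau>')) (i+1) \<subseteq> (\<eta>(k+1 := y)) i"
        using i W k \<tau>' unfolding walk_seq_def by auto
    qed simp
    ultimately show ?thesis unfolding path_seq_def by blast
  qed
  show ?thesis
  proof (cases "\<tau>' \<in> \<sigma> ` {1..r+1}")
    case True
    then obtain k where k: "k \<in> {1..r+1}" "\<sigma> k = \<tau>'" by blast
    then have "k \<noteq> 1" using \<tau>' by blast
    then have "path_seq K m n (k - 1) \<sigma> \<eta>" "k - 1 + 1 = k"
      using path_seq_truncate[OF P, of "k - 1"] k by auto
    then show ?thesis using k by metis
  next
    case new: False
    show ?thesis
    proof (cases "y \<in> \<eta> ` {1..r}")
      case True
      then obtain k where k: "k \<in> {1..r}" "\<eta> k = y" by blast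
      have sub: "\<sigma> k \<subseteq> y" using P k unfolding path_seq_def walk_seq_def by auto
      have "y \<notin> \<eta> ` {1..k-1}"
      proof
        assume "y \<in> \<eta> ` {1..k-1}"
        then obtain i where i: "i \<in> {1..k-1}" "\<eta> i = \<eta> k" using k(2) by auto
        then have "i = k" using P k(1) unfolding path_seq_def by (intro inj_onD[of \<eta> "{1..r}"]) auto
        then show False using i(1) by auto
      qed
      moreover have "\<tau>' \<notin> \<sigma> ` {1..k-1+1}" using new k by auto
      ultimately have "path_seq K m n k (\<sigma>(k+1 := \<tau>')) (\<eta>(k := y))"
        using app[of "k-1"] k(1) sub by (auto simp: numeral_2_eq_2)
      moreover have "(\<sigma>(k+1 := \<tau>')) 1 = \<sigma> 1" using k by auto
      ultimately show ?thesis by (metis fun_upd_same)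
    next
      case False
      have "path_seq K m n (Suc r) (\<sigma>(r+2 := \<tau>')) (\<eta>(r+1 := y))"
        using app[of r] False new y by auto
      moreover have "(\<sigma>(r+2 := \<tau>')) 1 = \<sigma> 1" "(\<sigma>(r+2 := \<tau>')) (Suc r + 1) = \<tau>'" by auto
      ultimately show ?thesis by blast
    qed
  qed
qed

text \<open>For fixed \<open>\<tau>\<close>, the facets whose ridges are all reachable from
  \<open>\<tau>\<close> are closed under adjacency, hence exhaust the facets; purity puts
  \<open>\<tau>'\<close> into one of them.\<close>

lemma linked_imp_connected:
  assumes L: "linked n (simplices K n)" and "1 \<le> n" and P: "pure_complex n V K"
  shows "connected_complex n K"
  unfolding connected_complex_def
proof (intro ballI impI)
  let ?F = "simplices K n" and ?R = "simplices K (n-1)"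
  fix \<tau> \<tau>' assume \<tau>: "\<tau> \<in> ?R" and \<tau>': "\<tau>' \<in> ?R" and ne: "\<tau> \<noteq> \<tau>'"
  define Q where "Q \<rho> \<longleftrightarrow> (\<exists>r \<sigma> \<eta>. path_seq K (n-1) n r \<sigma> \<eta> \<and> \<sigma> 1 = \<tau> \<and> \<sigma> (r+1) = \<rho>)" for \<rho>
  \<comment> \<open>The ridge \<open>\<tau>\<close> is exempted because a path sequence cannot
    return to its start.\<close>
  define G where "G = {x \<in> ?F. \<forall>\<rho>\<in>?R. \<rho> \<subseteq> x \<and> \<rho> \<noteq> \<tau> \<longrightarrow> Q \<rho>}"
  have base: "x \<in> G" if "x \<in> ?F" "\<tau> \<subseteq> x" for x
    using that path_seq_single[OF \<tau>, of _ x n] unfolding G_def Q_def by blast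
  have step: "y \<in> G" if x: "x \<in> G" and y: "y \<in> ?F" and c: "card (x \<inter> y) = n" for x y
  proof (cases "x \<inter> y = \<tau>")
    case True
    then show ?thesis using base y by blast
  next
    case False
    have "x \<in> K" "x \<inter> y \<noteq> {}" using x c \<open>1 \<le> n\<close> unfolding G_def simplices_def by auto
    then have "x \<inter> y \<in> K"
      using P unfolding pure_complex_def abstract_complex_def by (meson inf.cobounded1)
    then have "x \<inter> y \<in> ?R" using c \<open>1 \<le> n\<close> unfolding simplices_def by auto
    then have "Q (x \<inter> y)" using x False unfolding G_def by auto
    then have "Q \<rho>" if "\<rho> \<in> ?R" "\<rho> \<subseteq> y" "\<rho> \<noteq> \<tau>" for \<rho>
      using path_seq_extend[of K "n-1" n _ _ _ y \<rho>] y that unfolding Q_def by (metis inf.cobounded2)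
    then show ?thesis using y unfolding G_def by blast
  qed
  have facet: "\<exists>x\<in>?F. \<rho> \<subseteq> x" if "\<rho> \<in> ?R" for \<rho>
    using that P unfolding pure_complex_def simplices_def by auto
  have "G \<noteq> {}" using facet[OF \<tau>] base by blast
  moreover have "G \<subseteq> ?F" unfolding G_def by auto
  ultimately have "G = ?F" using L step unfolding linked_def by blast
  then have "Q \<tau>'" using facet[OF \<tau>'] \<tau>' ne unfolding G_def by blast
  then show "\<exists>r \<sigma> \<eta>. path_seq K (n-1) n r \<sigma> \<eta> \<and> \<sigma> 1 = \<tau> \<and> \<sigma> (r+1) = \<tau>'" unfolding Q_def .
qed


section \<open>Cycle sequences from shortest gaps\<close>

text \<open>Renumbers from 1, as \<open>cycle_seq\<close> does. The index \<open>i + a - 1\<close>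
  is exact for \<open>i \<ge> 1\<close>, even if \<open>a = 0\<close>.\<close>

lemma gap_walk_shift:
  assumes "gap_walk n F m a b \<eta> s"
  shows "gap_walk n F m 1 (b - a + 1) (\<lambda>i. \<eta> (i + a - 1)) s"
proof -
  have ab: "Suc a < b" using assms unfolding gap_walk_def by auto
  have s: "card s = Suc m" "s \<subseteq> \<eta> a" "s \<subseteq> \<eta> b"
    and mid: "\<And>k. a < k \<Longrightarrow> k < b \<Longrightarrow> \<not> s \<subseteq> \<eta> k"
    using assms unfolding gap_walk_def by auto
  have w: "\<And>i. a \<le> i \<Longrightarrow> i \<le> b \<Longrightarrow> \<eta> i \<in> F"
    "\<And>i. a \<le> i \<Longrightarrow> i < b \<Longrightarrow> card (\<eta> i \<inter> \<eta> (Suc i)) = n"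
    "\<And>i. a \<le> i \<Longrightarrow> Suc i < b \<Longrightarrow> \<not> \<eta> (Suc i) \<inter> \<eta> (Suc (Suc i)) \<subseteq> \<eta> i"
    using assms unfolding gap_walk_def reduced_walk_def by auto
  have "reduced_walk n F 1 (b - a + 1) (\<lambda>i. \<eta> (i + a - 1))"
    unfolding reduced_walk_def
  proof (intro conjI allI impI)
    fix i assume i: "1 \<le> i \<and> i \<le> b - a + 1"
    show "\<eta> (i + a - 1) \<in> F" by (rule w) (use i ab in auto)
  next
    fix i assume i: "1 \<le> i \<and> i < b - a + 1"
    then show "card (\<eta> (i + a - 1) \<inter> \<eta> (Suc i + a - 1)) = n"
      using w(2)[of "i + a - 1"] ab by auto
  next
    fix i assume i: "1 \<le> i \<and> Suc i < b - a + 1"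
    then have "a \<le> i + a - 1" "Suc (i + a - 1) < b" "Suc i + a - 1 = Suc (i + a - 1)"
      "Suc (Suc i) + a - 1 = Suc (Suc (i + a - 1))" by auto
    then show "\<not> \<eta> (Suc i + a - 1) \<inter> \<eta> (Suc (Suc i) + a - 1) \<subseteq> \<eta> (i + a - 1)"
      using w(3)[of "i + a - 1"] by metis
  qed
  moreover have "\<not> s \<subseteq> \<eta> (k + a - 1)" if "1 < k" "k < b - a + 1" for k
    by (rule mid) (use that in auto)
  ultimately show ?thesis unfolding gap_walk_def using s ab by auto
qed

text \<open>The length is minimised over all walks and all \<open>m\<close>-simplices together, so
  shorter stretches have no gap for any \<open>t\<close>, not only for \<open>s\<close>.\<close>

lemma shortest_gap_walk:
  assumes "\<not> gap_free n F m"
  obtains r \<eta> s where "gap_walk n F m 1 r \<eta> s"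
    "\<And>i j t. 1 \<le> i \<Longrightarrow> j \<le> r \<Longrightarrow> j - i < r - 1 \<Longrightarrow> \<not> gap_walk n F m i j \<eta> t"
proof -
  define P where "P l \<longleftrightarrow> (\<exists>a b \<eta> s. gap_walk n F m a b \<eta> s \<and> b - a = l)" for l
  have "\<exists>l. P l" using assms unfolding gap_free_def P_def by blast
  then obtain l where l: "P l" "\<And>l'. l' < l \<Longrightarrow> \<not> P l'" using exists_least_iff[of P] by blast
  then obtain a b \<eta> s where g: "gap_walk n F m a b \<eta> s" "b - a = l" unfolding P_def by blast
  show thesis
  proof (rule that[OF gap_walk_shift[OF g(1)]])
    fix i j t assume "j - i < b - a + 1 - 1"
    then have "\<not> P (j - i)" using l(2) g(2) by simp
    then show "\<not> gap_walk n F m i j (\<lambda>i. \<eta> (i + a - 1)) t" unfolding P_def by blast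
  qed
qed

text \<open>A shortest gap supplies the facets of the cycle: \<open>s\<close> is its first and last
  simplex, and the intersections of consecutive facets serve as the \<open>\<sigma>'\<close>.
  Minimality gives convexity on all proper stretches, from which distinctness follows.\<close>

lemma gap_walk_imp_cycle:
  assumes gap: "\<not> gap_free n (simplices K n) m" and "m < n" and A: "abstract_complex V K"
  shows "\<exists>r \<sigma> \<eta>. cycle_seq K m n r \<sigma> \<eta>"
proof -
  let ?F = "simplices K n"
  obtain r \<eta> s where g: "gap_walk n ?F m 1 r \<eta> s"
    and short: "\<And>i j t. 1 \<le> i \<Longrightarrow> j \<le> r \<Longrightarrow> j - i < r - 1 \<Longrightarrow> \<not> gap_walk n ?F m i j \<eta> t"
    using shortest_gap_walk[OF gap] by blast
  have w: "reduced_walk n ?F 1 r \<eta>" and r: "3 \<le> r" and s: "card s = Suc m" "s \<subseteq> \<eta> 1" "s \<subseteq> \<eta> r"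
    and mid: "\<And>k. 2 \<le> k \<Longrightarrow> k < r \<Longrightarrow> \<not> s \<subseteq> \<eta> k"
    using g unfolding gap_walk_def by auto
  have \<eta>F: "\<And>i. 1 \<le> i \<Longrightarrow> i \<le> r \<Longrightarrow> \<eta> i \<in> ?F"
    and adj: "\<And>i. 1 \<le> i \<Longrightarrow> i < r \<Longrightarrow> card (\<eta> i \<inter> \<eta> (Suc i)) = n"
    and red: "\<And>i. 1 \<le> i \<Longrightarrow> Suc i < r \<Longrightarrow> \<not> \<eta> (Suc i) \<inter> \<eta> (Suc (Suc i)) \<subseteq> \<eta> i"
    using w unfolding reduced_walk_def by auto
  have c\<eta>: "card (\<eta> i) = Suc n" "finite (\<eta> i)" if "1 \<le> i" "i \<le> r" for i
    using \<eta>F[OF that] unfolding simplices_def by (auto intro: card_ge_0_finite)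
  have conv: "t \<subseteq> \<eta> k"
    if "1 \<le> i" "j \<le> r" "j - i < r - 1" "card t = Suc m" "t \<subseteq> \<eta> i" "t \<subseteq> \<eta> j" "i \<le> k" "k \<le> j" for i j k t
    by (rule walk_convex[OF reduced_walk_sub[OF w that(1,2)] that(4-6) _ that(7,8)])
      (rule short, use that in auto)
  have inj: "\<eta> i \<noteq> \<eta> j" if ij: "1 \<le> i" "i < j" "j \<le> r" for i j
  proof
    assume eq: "\<eta> i = \<eta> j"
    show False
    proof (cases "j - i < r - 1")
      case True
      have "\<eta> i \<subseteq> \<eta> (Suc i)"
      proof (rule subset_by_card_subsets[of _ m])
        fix t assume "t \<subseteq> \<eta> i" "card t = Suc m"
        then show "t \<subseteq> \<eta> (Suc i)" using conv[of i j t "Suc i"] ij eq True by auto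
      qed (use c\<eta>[of i] ij \<open>m < n\<close> in auto)
      then have "\<eta> i \<inter> \<eta> (Suc i) = \<eta> i" by auto
      then show False using adj[of i] c\<eta>[of i] ij by auto
    next
      case False
      \<comment> \<open>Convexity fails for the whole walk, so it is applied from 2 to
        \<open>r\<close>: the ridge between \<open>\<eta> 1 = \<eta> r\<close> and
        \<open>\<eta> 2\<close> lies in \<open>\<eta> 3\<close>, making the first two ridges
        equal.\<close>
      then have ends: "i = 1" "j = r" using ij by auto
      have 12: "card (\<eta> 1 \<inter> \<eta> 2) = n" using adj[of 1] r by (simp add: numeral_2_eq_2)
      have 23: "card (\<eta> 2 \<inter> \<eta> 3) = n" using adj[of 2] r by (simp add: numeral_eq_Suc)
      have "\<eta> 1 \<inter> \<eta> 2 \<subseteq> \<eta> 3"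
      proof (rule subset_by_card_subsets[of _ m])
        fix t assume "t \<subseteq> \<eta> 1 \<inter> \<eta> 2" "card t = Suc m"
        then show "t \<subseteq> \<eta> 3" using conv[of 2 r t 3] eq ends r by auto
      qed (use c\<eta>[of 1] r 12 \<open>m < n\<close> in auto)
      then have "\<eta> 1 \<inter> \<eta> 2 \<subseteq> \<eta> 2 \<inter> \<eta> 3" by auto
      then have "\<eta> 1 \<inter> \<eta> 2 = \<eta> 2 \<inter> \<eta> 3" using c\<eta>[of 2] r 12 23 by (intro card_subset_eq) auto
      then show False using red[of 1] r by (auto simp: numeral_eq_Suc)
    qed
  qed
  \<comment> \<open>Each \<open>\<sigma>\<^sub>z\<close> is an \<open>m\<close>-face of \<open>\<eta>\<^sub>z\<^sub>-\<^sub>1 \<inter> \<eta>\<^sub>z\<close> through the vertex that entered at \<open>\<eta>\<^sub>z\<^sub>-\<^sub>1\<close>; by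
    convexity the index at which it first appears recovers \<open>z\<close>.\<close>
  have "\<exists>t. card t = Suc m \<and> t \<subseteq> \<eta> (z - 1) \<inter> \<eta> z \<and> (3 \<le> z \<longrightarrow> \<not> t \<subseteq> \<eta> (z - 2))"
    if z: "2 \<le> z" "z \<le> r" for z
  proof -
    have c: "card (\<eta> (z - 1) \<inter> \<eta> z) = n" using adj[of "z - 1"] z by (simp add: Suc_diff_le)
    have f: "finite (\<eta> (z - 1) \<inter> \<eta> z)" using c\<eta>[of z] z by auto
    obtain b where b: "b \<in> \<eta> (z - 1) \<inter> \<eta> z" "3 \<le> z \<longrightarrow> b \<notin> \<eta> (z - 2)"
    proof (cases "3 \<le> z")
      case True
      then have "Suc (z - 2) = z - 1" "Suc (Suc (z - 2)) = z" by auto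
      then have "\<not> \<eta> (z - 1) \<inter> \<eta> z \<subseteq> \<eta> (z - 2)" using red[of "z - 2"] True z by auto
      then show ?thesis using that by blast
    next
      case False
      \<comment> \<open>For \<open>z = 2\<close> no earlier facet has to be avoided, so any vertex
        of the ridge will do.\<close>
      have "\<eta> (z - 1) \<inter> \<eta> z \<noteq> {}" using c \<open>m < n\<close> by auto
      then show ?thesis using that False by blast
    qed
    obtain t where "{b} \<subseteq> t" "t \<subseteq> \<eta> (z - 1) \<inter> \<eta> z" "card t = Suc m"
      using exists_subset_between[of "{b}" "Suc m" "\<eta> (z - 1) \<inter> \<eta> z"] b f c \<open>m < n\<close> by auto
    then show ?thesis using b by blast
  qed
  then obtain T where T: "\<And>z. 2 \<le> z \<Longrightarrow> z \<le> r \<Longrightarrow> card (T z) = Suc m \<and> T z \<subseteq> \<eta> (z - 1) \<inter> \<eta> z \<and>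
      (3 \<le> z \<longrightarrow> \<not> T z \<subseteq> \<eta> (z - 2))"
    by metis
  \<comment> \<open>Serves twice: it separates the simplices \<open>T w\<close> and
    \<open>T z\<close> as well as the ridges at \<open>w\<close> and \<open>z\<close>.\<close>
  have late: "\<not> T z \<subseteq> \<eta> (w - 1) \<inter> \<eta> w" if wz: "2 \<le> w" "w < z" "z \<le> r" for w z
  proof
    assume sub: "T z \<subseteq> \<eta> (w - 1) \<inter> \<eta> w"
    have Tz: "card (T z) = Suc m" "T z \<subseteq> \<eta> z" "\<not> T z \<subseteq> \<eta> (z - 2)" using T[of z] wz by auto
    show False
    proof (cases "w = z - 1")
      case True
      then have "w - 1 = z - 2" by simp
      then show False using Tz sub by auto
    next
      case False
      then have "1 \<le> w" "z - w < r - 1" "w \<le> z - 2" "z - 2 \<le> z" using wz by auto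
      then show False using conv[of w z "T z" "z - 2"] wz Tz sub by auto
    qed
  qed
  have Tinj: "T w \<noteq> T z" if "2 \<le> w" "w < z" "z \<le> r" for w z
    using late[OF that] T[of w] that by auto
  \<comment> \<open>Each \<open>T z\<close> lies in an inner facet of the gap, and these avoid
    \<open>s\<close>.\<close>
  have Ts: "T z \<noteq> s" if z: "2 \<le> z" "z \<le> r" for z
  proof (cases "z = 2")
    case True
    then show ?thesis using T[of 2] mid[of 2] r by auto
  next
    case False
    then have "2 \<le> z - 1" "z - 1 < r" using z by auto
    then show ?thesis using T[of z] mid[of "z - 1"] z by auto
  qed
  define \<sigma> where "\<sigma> k = (if k = 1 \<or> k = r + 1 then s else T k)" for k
  define \<rho> where "\<rho> z = \<eta> (z - 1) \<inter> \<eta> z" for z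
  have face: "t \<in> simplices K d" if "t \<subseteq> \<eta> i" "1 \<le> i" "i \<le> r" "card t = Suc d" for t d i
  proof -
    have "t \<noteq> {}" using that by auto
    then have "t \<in> K" using A \<eta>F[OF that(2,3)] that(1) unfolding abstract_complex_def simplices_def by blast
    then show ?thesis using that(4) unfolding simplices_def by auto
  qed
  have \<sigma>T: "\<sigma> z = T z" if "2 \<le> z" "z \<le> r" for z using that unfolding \<sigma>_def by auto
  have \<sigma>s: "\<sigma> 1 = s" "\<sigma> (r+1) = s" unfolding \<sigma>_def by auto
  have \<sigma>inj: "\<sigma> i \<noteq> \<sigma> j" if "1 \<le> i" "i < j" "j \<le> r" for i j
    using that \<sigma>T[of i] \<sigma>T[of j] \<sigma>s Ts[of j] Tinj[of i j] by (cases "i = 1") auto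
  have \<sigma>sub: "\<sigma> k \<subseteq> \<eta> k" "\<sigma> (k + 1) \<subseteq> \<eta> k" if "1 \<le> k" "k \<le> r" for k
  proof -
    show "\<sigma> k \<subseteq> \<eta> k" using that \<sigma>T[of k] \<sigma>s s T[of k] by (cases "k = 1") auto
    show "\<sigma> (k + 1) \<subseteq> \<eta> k" using that \<sigma>T[of "k+1"] \<sigma>s s T[of "k+1"] by (cases "k = r") auto
  qed
  have \<sigma>card: "card (\<sigma> k) = Suc m" if "1 \<le> k" "k \<le> r + 1" for k
    using that T[of k] s unfolding \<sigma>_def by auto
  have \<sigma>K: "\<sigma> k \<in> simplices K m" if "1 \<le> k" "k \<le> r + 1" for k
  proof (cases "k = r + 1")
    case True
    then show ?thesis using face[of s r m] s r \<sigma>s by auto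
  next
    case False
    then show ?thesis using face[of "\<sigma> k" k m] \<sigma>sub \<sigma>card that by auto
  qed
  have walk: "walk_seq K m n r \<sigma> \<eta>"
    unfolding walk_seq_def
  proof (intro conjI ballI)
    fix k assume k: "k \<in> {1..r}"
    show "\<sigma> k \<noteq> \<sigma> (k+1)"
    proof (cases "k = r")
      case True
      then show ?thesis using \<sigma>s \<sigma>T[of r] Ts[of r] r by auto
    next
      case False
      then show ?thesis using \<sigma>inj[of k "k+1"] k by auto
    qed
  qed (use r \<sigma>K \<eta>F \<sigma>sub in auto)
  have \<rho>: "\<rho> z \<in> simplices K (n-1) \<and> \<rho> z \<subseteq> \<eta> (z-1) \<and> \<rho> z \<subseteq> \<eta> z \<and> \<sigma> z \<subseteq> \<rho> z"
    if "z \<in> {2..r}" for z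
  proof -
    have "card (\<rho> z) = n" using adj[of "z - 1"] that unfolding \<rho>_def by auto
    then have "\<rho> z \<in> simplices K (n-1)"
      using face[of "\<rho> z" z "n-1"] that \<open>m < n\<close> unfolding \<rho>_def by auto
    then show ?thesis using \<sigma>T[of z] T[of z] that unfolding \<rho>_def by auto
  qed
  have \<rho>inj: "\<rho> w \<noteq> \<rho> z" if "2 \<le> w" "w < z" "z \<le> r" for w z
    using late[OF that] T[of z] that unfolding \<rho>_def by auto
  have "cycle_seq K m n r \<sigma> \<eta>"
    unfolding cycle_seq_def
  proof (intro conjI exI[of _ \<rho>])
    show "inj_on \<sigma> {1..r}" using \<sigma>inj by (intro linorder_inj_onI) auto
    show "inj_on \<eta> {1..r}" using inj by (intro linorder_inj_onI) auto
    show "inj_on \<rho> {2..r}" using \<rho>inj by (intro linorder_inj_onI) auto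
    show "\<forall>k\<in>{2..r-1}. \<not> \<sigma> 1 \<subseteq> \<eta> k" using mid \<sigma>s by auto
  qed (use walk \<sigma>s r \<rho> in auto)
  then show ?thesis by blast
qed

section \<open>Simplicial trees characterised by their face numbers\<close>

theorem theorem5p5:
  fixes n p :: nat and V :: "'a set" and K :: "'a set set"
  assumes "n \<ge> 1"
    and "pure_complex n V K"
    and "card V = p"
  shows "simplicial_tree n V K \<longleftrightarrow>
    (\<exists>m<n. \<not> (\<exists>r \<sigma> \<eta>. cycle_seq K m n r \<sigma> \<eta>)) \<and>
    int (num_simplices (n-1) K) = (int p - int n) * int n + 1 \<and>
    int (num_simplices n K) = int p - int n"
proof -
  let ?F = "simplices K n"
  have A: "abstract_complex V K" "K \<noteq> {}" and pure: "\<And>\<tau>. \<tau> \<in> K \<Longrightarrow> \<exists>\<eta>\<in>?F. \<tau> \<subseteq> \<eta>"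
    using assms(2) unfolding pure_complex_def by auto
  have KV: "K \<subseteq> Pow V" "finite V" using A unfolding abstract_complex_def by auto
  have sub: "\<tau> \<in> K" if "\<sigma> \<in> K" "\<tau> \<noteq> {}" "\<tau> \<subseteq> \<sigma>" for \<sigma> \<tau>
    using A(1) that unfolding abstract_complex_def by blast
  have fin: "finite ?F" using KV unfolding simplices_def by (auto intro: finite_subset)
  have ne: "?F \<noteq> {}" using A(2) pure by blast
  have cF: "\<And>x. x \<in> ?F \<Longrightarrow> card x = Suc n" unfolding simplices_def by auto
  have V: "\<Union> ?F = V"
  proof
    show "\<Union> ?F \<subseteq> V" using KV unfolding simplices_def by auto
    show "V \<subseteq> \<Union> ?F"
    proof
      fix v assume "v \<in> V"
      then have "{v} \<in> K" using A(1) unfolding abstract_complex_def by blast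
      then show "v \<in> \<Union> ?F" using pure by blast
    qed
  qed
  have R: "\<Union> (ridges n ` ?F) = simplices K (n-1)"
  proof
    show "\<Union> (ridges n ` ?F) \<subseteq> simplices K (n-1)"
    proof
      fix \<tau> assume "\<tau> \<in> \<Union> (ridges n ` ?F)"
      then obtain x where x: "x \<in> K" "\<tau> \<subseteq> x" "card \<tau> = n" unfolding ridges_def simplices_def by auto
      then have "\<tau> \<in> K" using sub[of x \<tau>] \<open>n \<ge> 1\<close> by fastforce
      then show "\<tau> \<in> simplices K (n-1)" using x \<open>n \<ge> 1\<close> unfolding simplices_def by auto
    qed
    show "simplices K (n-1) \<subseteq> \<Union> (ridges n ` ?F)"
    proof
      fix \<tau> assume "\<tau> \<in> simplices K (n-1)"
      then have "\<tau> \<in> K" "card \<tau> = n" using \<open>n \<ge> 1\<close> unfolding simplices_def by auto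
      then show "\<tau> \<in> \<Union> (ridges n ` ?F)" using pure[of \<tau>] unfolding ridges_def by blast
    qed
  qed
  show ?thesis
  proof
    assume tree: "simplicial_tree n V K"
    then have C: "connected_complex n K" and nocyc: "\<not> (\<exists>r \<sigma> \<eta>. cycle_seq K 0 n r \<sigma> \<eta>)"
      using \<open>n \<ge> 1\<close> unfolding simplicial_tree_def acyclic_complex_def by auto
    have L: "linked n ?F" by (rule connected_imp_linked[OF C \<open>n \<ge> 1\<close> A(1)])
    have gf: "gap_free n ?F 0" using gap_walk_imp_cycle[OF _ _ A(1), of n 0] nocyc \<open>n \<ge> 1\<close> by auto
    obtain x where x: "x \<in> ?F" using ne by blast
    \<comment> \<open>Growth from a single facet bounds the number of vertices above; the private
      vertices of leaves bound it below.\<close>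
    have "card V + 1 \<le> n + 1 + card ?F"
      using linked_card_vertices_le[OF L fin, of "{x}"] cF x V by auto
    moreover have "n + card ?F \<le> card V"
      using card_vertices_gap_free[OF fin ne gf _ L cF] \<open>n \<ge> 1\<close> V by auto
    ultimately have p: "p = n + card ?F" using assms(3) by simp
    have "card (simplices K (n-1)) = n * card ?F + 1"
      using linked_card_ridges_le[OF L fin ne cF] card_ridges_gap_free[OF fin ne gf _ cF] \<open>n \<ge> 1\<close>
      unfolding R by auto
    then show "(\<exists>m<n. \<not> (\<exists>r \<sigma> \<eta>. cycle_seq K m n r \<sigma> \<eta>)) \<and>
      int (num_simplices (n-1) K) = (int p - int n) * int n + 1 \<and>
      int (num_simplices n K) = int p - int n"
      using p nocyc \<open>n \<ge> 1\<close> unfolding num_simplices_def by (auto intro!: exI[of _ 0])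
  next
    assume H: "(\<exists>m<n. \<not> (\<exists>r \<sigma> \<eta>. cycle_seq K m n r \<sigma> \<eta>)) \<and>
      int (num_simplices (n-1) K) = (int p - int n) * int n + 1 \<and>
      int (num_simplices n K) = int p - int n"
    then obtain m where m: "m < n" "\<not> (\<exists>r \<sigma> \<eta>. cycle_seq K m n r \<sigma> \<eta>)" by blast
    have cn: "int (card ?F) = int p - int n" using H unfolding num_simplices_def by blast
    \<comment> \<open>Substituting condition (3) into (2) eliminates \<open>p\<close> and leaves the
      equality case of the ridge bound.\<close>
    then have "int (card (simplices K (n-1))) = int (n * card ?F + 1)"
      using H unfolding num_simplices_def by simp
    then have cr: "card (\<Union> (ridges n ` ?F)) = n * card ?F + 1" unfolding R by linarith
    have gf: "gap_free n ?F m" using gap_walk_imp_cycle[OF _ m(1) A(1)] m(2) by blast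
    have L: "linked n ?F" using card_ridges_gap_free[OF fin ne gf m(1) cF] cr by blast
    have "card (\<Union> ?F) = n + card ?F" using cn V assms(3) by simp
    \<comment> \<open>Absence of cycles for the one given \<open>m\<close> yielded linkedness; the
      vertex count now excludes cycles for every \<open>m\<close>.\<close>
    then have "acyclic_complex n K"
      using cycle_imp_card_vertices_less[OF L fin _ \<open>n \<ge> 1\<close>] unfolding acyclic_complex_def by fastforce
    then show "simplicial_tree n V K"
      using assms(2) linked_imp_connected[OF L \<open>n \<ge> 1\<close> assms(2)] unfolding simplicial_tree_def by blast
  qed
qed

end
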